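(* Let $A$ and $B$ be finite nonempty subsets of an abelian group, and let $U_A$ and $U_B$ be independent random variables, with $U_A$ uniformly distributed on $A$ and $U_B$ uniformly distributed on $B$. Then $$\log\frac{|A|^2|B|^2}{|A+B|}\le \mathbf{A}\{U_A,U_B\}\le \log E(A,B).$$
   Context: $\log$ is the base-2 logarithm. $A+B=\{a+b: a\in A, b\in B\}$. The additive energy of $A,B$ is $E(A,B)=|\{(a,a',b,b')\in A\times A\times B\times B: a+b=a'+b'\}|$. All random variables are discrete, and $\mathbf{H}$ denotes Shannon entropy in base 2: $\mathbf{H}\{Z\}=\sum_z \mathbf{P}\{Z=z\}\log(1/\mathbf{P}\{Z=z\})$, with $\mathbf{H}\{X,Y\}$ the entropy of the pair $(X,Y)$. For discrete random variables $X,Y$ taking values in the same abelian group, let $(X_1,Y_1)$ and $(X_2,Y_2)$ be conditionally independent trials of $(X,Y)$ relative to $X+Y$; that is, conditionally on $X+Y=z$ (for each $z$ in the range of $X+Y$), the pairs $(X_1,Y_1)$ and $(X_2,Y_2)$ are independent and each has the distribution of $(X,Y)$ given $X+Y=z$ (so $X_1+Y_1=X_2+Y_2=X+Y$). The entropic additive energy is $\mathbf{A}\{X,Y\}=\mathbf{H}\{X_1,Y_1,X_2,Y_2\}$, which equals $2\mathbf{H}\{X,Y\}-\mathbf{H}\{X+Y\}$. *)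

theory Defs
  imports "HOL-Probability.Probability" "HOL-Library.Set_Algebras"
begin

definition discrete_rv :: "'w measure \<Rightarrow> ('w \<Rightarrow> 'b) \<Rightarrow> bool" where
  "discrete_rv M X \<longleftrightarrow> X \<in> M \<rightarrow>\<^sub>M count_space UNIV \<and> countable (X ` space M)"

text \<open>
  Terms with probability zero vanish, since the multiplier is zero. As for any real-valued
  infinite sum, the value is \<open>0\<close> when the series diverges; this does not arise for variables
  with finitely many values of positive probability.
\<close>

definition shannon_entropy :: "'w measure \<Rightarrow> ('w \<Rightarrow> 'b) \<Rightarrow> real" where
  "shannon_entropy M Z =
     (\<Sum>\<^sub>\<infinity>z. measure M {w \<in> space M. Z w = z} * log 2 (1 / measure M {w \<in> space M. Z w = z}))"

definition law :: "'w measure \<Rightarrow> ('w \<Rightarrow> 'b) \<Rightarrow> 'b pmf" where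
  "law M X = embed_pmf (\<lambda>x. measure M {w \<in> space M. X w = x})"

text \<open>
  The joint law of \<open>((X\<^sub>1, Y\<^sub>1), (X\<^sub>2, Y\<^sub>2))\<close>, where the two pairs are conditionally independent
  trials of a pair \<open>(X, Y)\<close> with law \<open>p\<close>, relative to \<open>X + Y\<close>: draw \<open>z\<close> with the law of \<open>X + Y\<close>,
  then draw two independent pairs, each with the law of \<open>(X, Y)\<close> given \<open>X + Y = z\<close>.
\<close>

definition sum_trials :: "('a::plus \<times> 'a) pmf \<Rightarrow> (('a \<times> 'a) \<times> ('a \<times> 'a)) pmf" where
  "sum_trials p =
     bind_pmf (map_pmf (\<lambda>(x, y). x + y) p)
       (\<lambda>z. pair_pmf (cond_pmf p {(x, y). x + y = z}) (cond_pmf p {(x, y). x + y = z}))"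

definition entropic_additive_energy ::
    "'w measure \<Rightarrow> ('w \<Rightarrow> 'a::ab_group_add) \<Rightarrow> ('w \<Rightarrow> 'a) \<Rightarrow> real" where
  "entropic_additive_energy M X Y =
     shannon_entropy (measure_pmf (sum_trials (law M (\<lambda>w. (X w, Y w)))))
       (\<lambda>((x1, y1), (x2, y2)). (x1, y1, x2, y2))"

definition additive_energy :: "'a::ab_group_add set \<Rightarrow> 'a set \<Rightarrow> nat" where
  "additive_energy A B =
     card {(a, a', b, b'). a \<in> A \<and> a' \<in> A \<and> b \<in> B \<and> b' \<in> B \<and> a + b = a' + b'}"

lemma measure_pmf_law:
  assumes M: "prob_space M" and X: "discrete_rv M X"
  shows "measure_pmf (law M X) = distr M (count_space UNIV) X"
proof -
  interpret prob_space M by (rule M)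
  let ?D = "distr M (count_space UNIV) X"
  have meas: "X \<in> M \<rightarrow>\<^sub>M count_space UNIV" and cnt: "countable (X ` space M)"
    using X by (auto simp: discrete_rv_def)
  interpret D: prob_space ?D by (rule prob_space_distr[OF meas])
  have pt: "measure ?D {x} = measure M {w \<in> space M. X w = x}" for x
    using meas by (subst measure_distr) (auto intro!: arg_cong[where f="measure M"])
  have "AE x in ?D. x \<in> X ` space M"
    using meas by (subst AE_distr_iff) auto
  then have "AE x in ?D. measure ?D {x} \<noteq> 0"
    by (subst D.AE_support_countable) (use cnt in auto)
  then obtain q where q: "measure_pmf q = ?D"
    using Abs_pmf_inverse[of ?D] D.prob_space_axioms by auto
  have "pmf q = (\<lambda>x. measure M {w \<in> space M. X w = x})"
    by (auto simp: pt[symmetric] q[symmetric] measure_pmf_single)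
  then have "law M X = q"
    unfolding law_def using type_definition.Rep_inverse[OF td_pmf_embed_pmf, of q] by simp
  then show ?thesis by (simp add: q)
qed

lemma pmf_sum_trials:
  "pmf (sum_trials p) ((x1, y1), (x2, y2)) =
     (if x1 + y1 = x2 + y2
      then pmf p (x1, y1) * pmf p (x2, y2) / measure_pmf.prob p {(x, y). x + y = x1 + y1}
      else 0)"
proof -
  let ?q = "map_pmf (\<lambda>(x, y). x + y) p"
  let ?S = "\<lambda>z. {(x, y). x + y = z}"
  let ?K = "\<lambda>z. pair_pmf (cond_pmf p (?S z)) (cond_pmf p (?S z))"
  have q: "pmf ?q z = measure p (?S z)" for z
    by (auto simp: pmf_map vimage_def intro!: arg_cong[where f="measure p"])
  have K: "pmf (?K z) ((x1, y1), (x2, y2)) =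
      (if z = x1 + y1 \<and> z = x2 + y2
       then pmf p (x1, y1) * pmf p (x2, y2) / (measure p (?S z))\<^sup>2 else 0)"
    if "z \<in> set_pmf ?q" for z
  proof -
    have "set_pmf p \<inter> ?S z \<noteq> {}" using that by auto
    then show ?thesis by (auto simp: pmf_pair pmf_cond power2_eq_square)
  qed
  have "pmf (sum_trials p) ((x1, y1), (x2, y2)) =
      (\<integral>z. pmf (?K z) ((x1, y1), (x2, y2)) \<partial>measure_pmf ?q)"
    by (simp add: sum_trials_def pmf_bind)
  also have "\<dots> = (\<integral>z. (if z = x1 + y1 \<and> z = x2 + y2
       then pmf p (x1, y1) * pmf p (x2, y2) / (measure p (?S z))\<^sup>2 else 0) \<partial>measure_pmf ?q)"
    by (intro integral_cong_AE) (auto simp: AE_measure_pmf_iff K)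
  also have "\<dots> = (if x1 + y1 = x2 + y2
      then pmf p (x1, y1) * pmf p (x2, y2) / measure p (?S (x1 + y1)) else 0)"
    by (subst integral_measure_pmf_real[where A="{x1 + y1}"])
       (simp_all add: q power2_eq_square split: if_splits)
  finally show ?thesis .
qed

lemma (in prob_space) shannon_entropy_eq_entropy:
  assumes X: "simple_function M X"
  shows "shannon_entropy M X = entropy 2 (count_space (X ` space M)) X"
proof -
  interpret information_space M 2 by standard simp
  let ?P = "\<lambda>x. measure M {w \<in> space M. X w = x}"
  have fin: "finite (X ` space M)" using X by (rule simple_functionD)
  have "simple_distributed M X ?P"
    using X by (intro simple_distributedI)
      (auto intro!: arg_cong[where f="measure M"])
  then have "entropy 2 (count_space (X ` space M)) X = - (\<Sum>x\<in>X ` space M. ?P x * log 2 (?P x))"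
    by (rule entropy_simple_distributed)
  also have "\<dots> = (\<Sum>x\<in>X ` space M. ?P x * log 2 (1 / ?P x))"
    unfolding sum_negf[symmetric]
  proof (intro sum.cong refl)
    fix x
    show "- (?P x * log 2 (?P x)) = ?P x * log 2 (1 / ?P x)"
      using log_inverse[of 2 "?P x"] measure_nonneg[of M "{w \<in> space M. X w = x}"]
      by (cases "?P x = 0") (simp_all add: inverse_eq_divide)
  qed
  also have "\<dots> = (\<Sum>\<^sub>\<infinity>x\<in>X ` space M. ?P x * log 2 (1 / ?P x))"
    using fin by simp
  also have "\<dots> = shannon_entropy M X"
    unfolding shannon_entropy_def
  proof (rule infsum_cong_neutral)
    fix z assume "z \<in> UNIV - X ` space M"
    then have "{w \<in> space M. X w = z} = {}" by auto
    then have "?P z = 0" by (simp only: measure_empty)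
    then show "?P z * log 2 (1 / ?P z) = 0" by (simp only: mult_zero_left)
  qed auto
  finally show ?thesis by simp
qed

end

theory Submission
  imports Defs
begin

text \<open>
  Let \<open>U\<close> be a pair drawn uniformly from a finite set \<open>G\<close> of \<open>n\<close> pairs; for the theorem,
  \<open>G = A \<times> B\<close>, because independent uniform variables are jointly uniform. If \<open>r z\<close> pairs of \<open>G\<close>
  have sum \<open>z\<close>, then the two conditionally independent trials are distributed on the pairs of
  elements of \<open>G\<close> with a common sum, and a pair of trials with common sum \<open>z\<close> has
  probability \<open>1 / (n * r z)\<close>.

  Both bounds are the same fact, that a distribution on \<open>k\<close> points has entropy at most
  \<open>log k\<close> (lemma \<open>finite_entropy_le_log_card\<close>), applied to two distributions. Applied to the trials
  it gives the upper bound, since their support is counted by the additive energy. For the lower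
  bound, each of the \<open>r z * r z\<close> pairs of trials with common sum \<open>z\<close> contributes
  \<open>log (n * r z) = 2 * log n - log (n / r z)\<close> with weight \<open>1 / (n * r z)\<close>, so that the entropy of
  the trials is \<open>2 * log n\<close> minus the entropy of the sum, whose distribution \<open>r z / n\<close> lives
  on \<open>card (A + B)\<close> points.
\<close>

text \<open>
  This is Gibbs' inequality against the uniform distribution: \<open>ln x \<le> x - 1\<close> at
  \<open>x = 1 / (p t * card T)\<close>, averaged with the weights \<open>p t\<close>.
\<close>

lemma finite_entropy_le_log_card:
  fixes p :: "'t \<Rightarrow> real"
  assumes fin: "finite T" and nonneg: "\<And>t. t \<in> T \<Longrightarrow> 0 \<le> p t" and total: "(\<Sum>t\<in>T. p t) = 1"
  shows "(\<Sum>t\<in>T. p t * log 2 (1 / p t)) \<le> log 2 (real (card T))"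
proof -
  have "T \<noteq> {}" using total by auto
  with fin have c: "real (card T) > 0" by (simp add: card_gt_0_iff)
  have "p t * log 2 (1 / p t) \<le> p t * log 2 (real (card T)) + (1 / real (card T) - p t) / ln 2"
    if "t \<in> T" for t
  proof (cases "p t = 0")
    case False
    with nonneg[OF that] have pt: "p t > 0" by simp
    have "p t * (ln (1 / p t) - ln (real (card T))) = p t * ln (1 / (p t * real (card T)))"
      using pt c by (simp add: ln_div ln_mult)
    also have "\<dots> \<le> p t * (1 / (p t * real (card T)) - 1)"
      using pt c by (intro mult_left_mono ln_le_minus_one) auto
    also have "\<dots> = 1 / real (card T) - p t"
      using pt c by (simp add: field_simps)
    finally have "p t * ln (1 / p t) \<le> p t * ln (real (card T)) + (1 / real (card T) - p t)"
      by (simp add: right_diff_distrib)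
    then have "p t * ln (1 / p t) / ln 2
        \<le> (p t * ln (real (card T)) + (1 / real (card T) - p t)) / ln 2"
      by (rule divide_right_mono) simp
    then show ?thesis by (simp add: log_def add_divide_distrib)
  qed simp
  then have "(\<Sum>t\<in>T. p t * log 2 (1 / p t))
      \<le> (\<Sum>t\<in>T. p t * log 2 (real (card T)) + (1 / real (card T) - p t) / ln 2)"
    by (rule sum_mono)
  also have "\<dots> = log 2 (real (card T))"
    using c total by (simp add: sum.distrib sum_subtractf
        flip: sum_divide_distrib sum_distrib_right)
  finally show ?thesis .
qed

text \<open>
  An injective reading of the outcome does not change the entropy. The finite set may be larger
  than the support, because points of probability zero contribute nothing.
\<close>

lemma shannon_entropy_pmf_inj:
  assumes inj: "inj f" and fin: "finite S" and supp: "set_pmf q \<subseteq> S"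
  shows "shannon_entropy (measure_pmf q) f = (\<Sum>w\<in>S. pmf q w * log 2 (1 / pmf q w))"
proof -
  have P: "measure (measure_pmf q) {w \<in> space (measure_pmf q). f w = f v} = pmf q v" for v
  proof -
    have "{w. f w = f v} = {v}" using inj by (auto dest: injD)
    then show ?thesis by (simp add: measure_pmf_single)
  qed
  let ?g = "\<lambda>z. measure (measure_pmf q) {w \<in> space (measure_pmf q). f w = z}"
  have zero: "?g z = 0" if "z \<notin> f ` S" for z
    using that supp by (auto simp: measure_pmf_zero_iff)
  have "shannon_entropy (measure_pmf q) f = (\<Sum>\<^sub>\<infinity>z\<in>f ` S. ?g z * log 2 (1 / ?g z))"
    unfolding shannon_entropy_def
    by (rule infsum_cong_neutral) (use zero in auto)
  also have "\<dots> = (\<Sum>z\<in>f ` S. ?g z * log 2 (1 / ?g z))"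
    using fin by simp
  also have "\<dots> = (\<Sum>w\<in>S. ?g (f w) * log 2 (1 / ?g (f w)))"
    by (subst sum.reindex) (use inj in \<open>auto intro: inj_on_subset\<close>)
  finally show ?thesis by (simp only: P)
qed

lemma law_eqI:
  assumes "\<And>x. measure M {w \<in> space M. X w = x} = pmf q x"
  shows "law M X = q"
  unfolding law_def assms using type_definition.Rep_inverse[OF td_pmf_embed_pmf, of q] by simp

lemma (in prob_space) law_indep_uniform_pair:
  assumes A: "finite A" "A \<noteq> {}" and B: "finite B" "B \<noteq> {}"
    and X: "X \<in> M \<rightarrow>\<^sub>M count_space UNIV" and Y: "Y \<in> M \<rightarrow>\<^sub>M count_space UNIV"
    and indep: "indep_var (count_space UNIV) X (count_space UNIV) Y"
    and distr_X: "distr M (count_space UNIV) X = measure_pmf (pmf_of_set A)"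
    and distr_Y: "distr M (count_space UNIV) Y = measure_pmf (pmf_of_set B)"
  shows "law M (\<lambda>w. (X w, Y w)) = pmf_of_set (A \<times> B)"
proof (rule law_eqI)
  have marginal: "prob (Z -` {z} \<inter> space M) = pmf q z"
    if "Z \<in> M \<rightarrow>\<^sub>M count_space UNIV" "distr M (count_space UNIV) Z = measure_pmf q"
    for Z :: "'a \<Rightarrow> 'b" and q z
    using measure_distr[OF that(1), of "{z}"] that(2) by (simp add: measure_pmf_single)
  fix v :: "'b \<times> 'b"
  obtain x y where v: "v = (x, y)" by (cases v)
  have "prob {w \<in> space M. (X w, Y w) = v} = prob ((\<lambda>w. (X w, Y w)) -` ({x} \<times> {y}) \<inter> space M)"
    unfolding v by (intro arg_cong[where f = prob]) auto
  also have "\<dots> = prob (X -` {x} \<inter> space M) * prob (Y -` {y} \<inter> space M)"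
    by (rule indep_varD[OF indep]) auto
  also have "\<dots> = pmf (pmf_of_set A) x * pmf (pmf_of_set B) y"
    using marginal[OF X distr_X] marginal[OF Y distr_Y] by simp
  also have "\<dots> = pmf (pmf_of_set (A \<times> B)) v"
    using A B by (auto simp: v indicator_def card_cartesian_product)
  finally show "prob {w \<in> space M. (X w, Y w) = v} = pmf (pmf_of_set (A \<times> B)) v" .
qed

definition sum_fiber :: "('a::plus \<times> 'a) set \<Rightarrow> 'a \<Rightarrow> ('a \<times> 'a) set" where
  "sum_fiber G z = {(x, y) \<in> G. x + y = z}"

definition same_sum_pairs :: "('a::plus \<times> 'a) set \<Rightarrow> (('a \<times> 'a) \<times> ('a \<times> 'a)) set" where
  "same_sum_pairs G = {(u, v) \<in> G \<times> G. fst u + snd u = fst v + snd v}"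

abbreviation pair_sums :: "('a::plus \<times> 'a) set \<Rightarrow> 'a set" where
  "pair_sums G \<equiv> (\<lambda>(x, y). x + y) ` G"

lemma finite_sum_fiber: "finite G \<Longrightarrow> finite (sum_fiber G z)"
  by (rule finite_subset[of _ G]) (auto simp: sum_fiber_def)

lemma finite_same_sum_pairs: "finite G \<Longrightarrow> finite (same_sum_pairs G)"
  by (rule finite_subset[of _ "G \<times> G"]) (auto simp: same_sum_pairs_def)

lemma card_sum_fiber_pos:
  assumes "finite G" "z \<in> pair_sums G"
  shows "card (sum_fiber G z) > 0"
  using assms finite_sum_fiber[of G z] by (auto simp: card_gt_0_iff sum_fiber_def)

lemma sum_card_sum_fiber:
  assumes "finite G"
  shows "(\<Sum>z\<in>pair_sums G. card (sum_fiber G z)) = card G"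
proof -
  have "card (\<Union>z\<in>pair_sums G. sum_fiber G z) = (\<Sum>z\<in>pair_sums G. card (sum_fiber G z))"
    using assms finite_sum_fiber[of G] by (intro card_UN_disjoint) (auto simp: sum_fiber_def)
  moreover have "(\<Union>z\<in>pair_sums G. sum_fiber G z) = G"
    by (auto simp: sum_fiber_def)
  ultimately show ?thesis by simp
qed

text \<open>Two pairs with a common sum are a choice of that sum and of two elements of its fiber.\<close>

lemma sum_same_sum_pairs:
  fixes G :: "('a::plus \<times> 'a) set" and h :: "'a \<Rightarrow> real"
  assumes "finite G"
  shows "(\<Sum>w\<in>same_sum_pairs G. h (fst (fst w) + snd (fst w)))
       = (\<Sum>z\<in>pair_sums G. (real (card (sum_fiber G z)))\<^sup>2 * h z)"
proof -
  let ?F = "\<lambda>z. sum_fiber G z \<times> sum_fiber G z"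
  have "same_sum_pairs G = (\<Union>z\<in>pair_sums G. ?F z)"
    by (force simp: same_sum_pairs_def sum_fiber_def)
  then have "(\<Sum>w\<in>same_sum_pairs G. h (fst (fst w) + snd (fst w)))
      = (\<Sum>z\<in>pair_sums G. \<Sum>w\<in>?F z. h (fst (fst w) + snd (fst w)))"
    using assms by (simp only:) (rule sum.UNION_disjoint,
      auto simp: finite_sum_fiber, auto simp: sum_fiber_def)
  also have "\<dots> = (\<Sum>z\<in>pair_sums G. \<Sum>w\<in>?F z. h z)"
    by (intro sum.cong refl) (auto simp: sum_fiber_def)
  finally show ?thesis
    by (simp add: card_cartesian_product power2_eq_square)
qed

text \<open>
  With \<open>n = card G\<close> and \<open>r\<close> elements of \<open>G\<close> of the given sum, the value is
  \<open>(1/n) * (1/n)\<close> divided by the probability \<open>r/n\<close> of that sum.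
\<close>

lemma pmf_sum_trials_uniform:
  fixes G :: "('a::plus \<times> 'a) set"
  assumes G: "finite G" "G \<noteq> {}"
  shows "pmf (sum_trials (pmf_of_set G)) w =
    (if w \<in> same_sum_pairs G
     then 1 / (real (card G) * real (card (sum_fiber G (fst (fst w) + snd (fst w))))) else 0)"
proof -
  obtain x1 y1 x2 y2 where w: "w = ((x1, y1), (x2, y2))" by (metis prod.exhaust)
  have "measure (measure_pmf (pmf_of_set G)) {(x, y). x + y = z}
      = real (card (sum_fiber G z)) / real (card G)" for z
  proof -
    have "G \<inter> {(x, y). x + y = z} = sum_fiber G z" by (auto simp: sum_fiber_def)
    then show ?thesis using G by (simp add: measure_pmf_of_set)
  qed
  then show ?thesis
    using G by (auto simp: w pmf_sum_trials same_sum_pairs_def indicator_def)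
qed

lemma set_pmf_sum_trials_uniform:
  assumes "finite G" "G \<noteq> {}"
  shows "set_pmf (sum_trials (pmf_of_set G)) \<subseteq> same_sum_pairs G"
  by (auto simp: set_pmf_iff pmf_sum_trials_uniform[OF assms] split: if_splits)

text \<open>
  This is \<open>\<^bold>H{X\<^sub>1, Y\<^sub>1, X\<^sub>2, Y\<^sub>2} = 2 \<^bold>H{X, Y} - \<^bold>H{X + Y}\<close> for uniform \<open>(X, Y)\<close>: the subtracted sum is
  the entropy of \<open>X + Y\<close>, written with the fiber sizes.
\<close>

lemma entropy_sum_trials_uniform:
  fixes G :: "('a::plus \<times> 'a) set"
  assumes G: "finite G" "G \<noteq> {}"
  defines "q \<equiv> sum_trials (pmf_of_set G)"
  shows "(\<Sum>w\<in>same_sum_pairs G. pmf q w * log 2 (1 / pmf q w))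
    = 2 * log 2 (real (card G))
      - (\<Sum>z\<in>pair_sums G. real (card (sum_fiber G z)) / real (card G)
            * log 2 (1 / (real (card (sum_fiber G z)) / real (card G))))"
proof -
  let ?n = "real (card G)" and ?r = "\<lambda>z. real (card (sum_fiber G z))"
  have n: "?n > 0" using G by (simp add: card_gt_0_iff)
  have "(\<Sum>w\<in>same_sum_pairs G. pmf q w * log 2 (1 / pmf q w))
      = (\<Sum>w\<in>same_sum_pairs G. (\<lambda>z. 1 / (?n * ?r z) * log 2 (?n * ?r z)) (fst (fst w) + snd (fst w)))"
    by (intro sum.cong refl) (simp add: q_def pmf_sum_trials_uniform[OF G])
  also have "\<dots> = (\<Sum>z\<in>pair_sums G. (?r z)\<^sup>2 * (1 / (?n * ?r z) * log 2 (?n * ?r z)))"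
    by (rule sum_same_sum_pairs[OF G(1)])
  also have "\<dots> = (\<Sum>z\<in>pair_sums G.
      ?r z / ?n * (2 * log 2 ?n) - ?r z / ?n * log 2 (1 / (?r z / ?n)))"
  proof (intro sum.cong refl)
    fix z assume "z \<in> pair_sums G"
    then have r: "?r z > 0" using card_sum_fiber_pos[OF G(1)] by simp
    have "log 2 (?n * ?r z) = 2 * log 2 ?n - log 2 (1 / (?r z / ?n))"
      using r n by (simp add: log_mult log_divide)
    moreover have "(?r z)\<^sup>2 * (1 / (?n * ?r z) * x) = ?r z / ?n * x" for x
      using r n by (simp add: power2_eq_square)
    ultimately show "(?r z)\<^sup>2 * (1 / (?n * ?r z) * log 2 (?n * ?r z))
        = ?r z / ?n * (2 * log 2 ?n) - ?r z / ?n * log 2 (1 / (?r z / ?n))"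
      by (simp only: right_diff_distrib)
  qed
  also have "\<dots> = (\<Sum>z\<in>pair_sums G. ?r z / ?n) * (2 * log 2 ?n)
      - (\<Sum>z\<in>pair_sums G. ?r z / ?n * log 2 (1 / (?r z / ?n)))"
    by (simp only: sum_subtractf sum_distrib_right)
  also have "(\<Sum>z\<in>pair_sums G. ?r z / ?n) = 1"
    using n by (simp add: sum_card_sum_fiber[OF G(1)] flip: sum_divide_distrib of_nat_sum)
  finally show ?thesis by simp
qed

lemma entropy_sum_trials_uniform_bounds:
  fixes G :: "('a::plus \<times> 'a) set"
  assumes G: "finite G" "G \<noteq> {}"
  defines "q \<equiv> sum_trials (pmf_of_set G)"
  shows "log 2 ((real (card G))\<^sup>2 / real (card (pair_sums G)))
           \<le> (\<Sum>w\<in>same_sum_pairs G. pmf q w * log 2 (1 / pmf q w))"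
    and "(\<Sum>w\<in>same_sum_pairs G. pmf q w * log 2 (1 / pmf q w))
           \<le> log 2 (real (card (same_sum_pairs G)))"
proof -
  let ?n = "real (card G)" and ?r = "\<lambda>z. real (card (sum_fiber G z))"
  have n: "?n > 0" using G by (simp add: card_gt_0_iff)
  have m: "real (card (pair_sums G)) > 0" using G by (simp add: card_gt_0_iff)
  have "(\<Sum>z\<in>pair_sums G. ?r z / ?n) = 1"
    using n by (simp add: sum_card_sum_fiber[OF G(1)] flip: sum_divide_distrib of_nat_sum)
  then have "(\<Sum>z\<in>pair_sums G. ?r z / ?n * log 2 (1 / (?r z / ?n)))
      \<le> log 2 (real (card (pair_sums G)))"
    using G by (intro finite_entropy_le_log_card) auto
  moreover have "log 2 (?n\<^sup>2 / real (card (pair_sums G)))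
      = 2 * log 2 ?n - log 2 (real (card (pair_sums G)))"
    using n m by (simp add: log_divide log_nat_power)
  ultimately show "log 2 (?n\<^sup>2 / real (card (pair_sums G)))
      \<le> (\<Sum>w\<in>same_sum_pairs G. pmf q w * log 2 (1 / pmf q w))"
    unfolding q_def entropy_sum_trials_uniform[OF G] by linarith
  have "set_pmf q \<subseteq> same_sum_pairs G"
    unfolding q_def by (rule set_pmf_sum_trials_uniform[OF G])
  then have "(\<Sum>w\<in>same_sum_pairs G. pmf q w) = 1"
    by (rule sum_pmf_eq_1[OF finite_same_sum_pairs[OF G(1)]])
  then show "(\<Sum>w\<in>same_sum_pairs G. pmf q w * log 2 (1 / pmf q w))
      \<le> log 2 (real (card (same_sum_pairs G)))"
    by (intro finite_entropy_le_log_card finite_same_sum_pairs G) auto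
qed

lemma card_same_sum_pairs_times:
  fixes A B :: "'a::ab_group_add set"
  shows "card (same_sum_pairs (A \<times> B)) = additive_energy A B"
  unfolding additive_energy_def
  by (rule bij_betw_same_card
      [OF bij_betw_byWitness[where f = "\<lambda>((a, b), (a', b')). (a, a', b, b')"
        and f' = "\<lambda>(a, a', b, b'). ((a, b), (a', b'))"]])
    (auto simp: same_sum_pairs_def)

theorem proposition1:
  fixes M :: "'w measure"
    and A B :: "'a::ab_group_add set"
    and U\<^sub>A U\<^sub>B :: "'w \<Rightarrow> 'a"
  assumes "finite A" "A \<noteq> {}" "finite B" "B \<noteq> {}"
    and "prob_space M"
    and "discrete_rv M U\<^sub>A" "discrete_rv M U\<^sub>B"
    and "prob_space.indep_var M (count_space UNIV) U\<^sub>A (count_space UNIV) U\<^sub>B"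
    and "distr M (count_space UNIV) U\<^sub>A = measure_pmf (pmf_of_set A)"
    and "distr M (count_space UNIV) U\<^sub>B = measure_pmf (pmf_of_set B)"
  shows "log 2 ((real (card A))\<^sup>2 * (real (card B))\<^sup>2 / real (card (A + B)))
           \<le> entropic_additive_energy M U\<^sub>A U\<^sub>B
         \<and> entropic_additive_energy M U\<^sub>A U\<^sub>B \<le> log 2 (real (additive_energy A B))"
proof -
  interpret prob_space M by (rule assms)
  let ?p = "pmf_of_set (A \<times> B)"
  have G: "finite (A \<times> B)" "A \<times> B \<noteq> {}" using assms(1-4) by auto
  have "law M (\<lambda>w. (U\<^sub>A w, U\<^sub>B w)) = ?p"
    using assms by (intro law_indep_uniform_pair) (auto simp: discrete_rv_def)
  moreover have "inj (\<lambda>((x1, y1), (x2, y2)). (x1, y1, x2, y2) :: 'a \<times> 'a \<times> 'a \<times> 'a)"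
    by (auto simp: inj_on_def)
  ultimately have "entropic_additive_energy M U\<^sub>A U\<^sub>B = (\<Sum>w\<in>same_sum_pairs (A \<times> B).
      pmf (sum_trials ?p) w * log 2 (1 / pmf (sum_trials ?p) w))"
    unfolding entropic_additive_energy_def
    by (simp only: shannon_entropy_pmf_inj[OF _ finite_same_sum_pairs[OF G(1)]
          set_pmf_sum_trials_uniform[OF G]])
  moreover have "pair_sums (A \<times> B) = A + B"
    by (auto simp: set_plus_def)
  moreover have "(real (card (A \<times> B)))\<^sup>2 = (real (card A))\<^sup>2 * (real (card B))\<^sup>2"
    by (simp add: card_cartesian_product power_mult_distrib)
  ultimately show ?thesis
    using entropy_sum_trials_uniform_bounds[OF G] by (simp only: card_same_sum_pairs_times)
qed

end
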